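(* Let $\mathbb{Q}$ be the field of rational numbers. Then for each $n \geq 2$ there exist non-bijective linear maps $T\colon M_n(\mathbb{Q}) \to M_n(\mathbb{Q})$ which preserve $\mathcal{L}$ and $\mathcal{H}$ and which are not of the form $A \mapsto PAX$ with $P \in GL_n(\mathbb{Q})$ and $X \in M_n(\mathbb{Q})$.
   Context: $M_n(K)$ is the set of $n \times n$ matrices over a field $K$, viewed as a $K$-vector space and as a monoid under multiplication; $GL_n(K)$ is its group of invertible matrices. Green's relations on $M_n(K)$: $A\,\mathcal{L}\,B$ if there exist $X, Y \in M_n(K)$ with $A = XB$ and $B = YA$; $A\,\mathcal{R}\,B$ if there exist $X, Y \in M_n(K)$ with $A = BX$ and $B = AY$; $A\,\mathcal{H}\,B$ if $A\,\mathcal{L}\,B$ and $A\,\mathcal{R}\,B$. A map $T$ preserves a binary relation $\equiv$ on $M_n(K)$ if $A \equiv B$ implies $T(A) \equiv T(B)$ for all $A,B \in M_n(K)$. *)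

theory Defs
  imports "HOL-Analysis.Analysis"
begin

text \<open>
  The monoid and vector space of square matrices over a field is the type \<open>'a ^ 'n ^ 'n\<close>; its size
  is \<open>CARD('n)\<close>. The library operation \<open>(*s)\<close> would multiply each row of a matrix componentwise by a vector, so
  multiplication by a field element is introduced separately.
\<close>

definition mat_scale :: "'a::field \<Rightarrow> 'a ^ 'n ^ 'n \<Rightarrow> 'a ^ 'n ^ 'n" where
  "mat_scale c A = (\<chi> i j. c * A $ i $ j)"

lemma vector_space_mat_scale: "vector_space mat_scale"
  by unfold_locales (simp_all add: mat_scale_def vec_eq_iff algebra_simps)

definition green_L :: "'a::field ^ 'n ^ 'n \<Rightarrow> 'a ^ 'n ^ 'n \<Rightarrow> bool" where
  "green_L A B \<longleftrightarrow> (\<exists>X Y. A = X ** B \<and> B = Y ** A)"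

definition green_R :: "'a::field ^ 'n ^ 'n \<Rightarrow> 'a ^ 'n ^ 'n \<Rightarrow> bool" where
  "green_R A B \<longleftrightarrow> (\<exists>X Y. A = B ** X \<and> B = A ** Y)"

definition green_H :: "'a::field ^ 'n ^ 'n \<Rightarrow> 'a ^ 'n ^ 'n \<Rightarrow> bool" where
  "green_H A B \<longleftrightarrow> green_L A B \<and> green_R A B"

definition preserves_rel :: "('b \<Rightarrow> 'b) \<Rightarrow> ('b \<Rightarrow> 'b \<Rightarrow> bool) \<Rightarrow> bool" where
  "preserves_rel T R \<longleftrightarrow> (\<forall>A B. R A B \<longrightarrow> R (T A) (T B))"

end

theory Submission
  imports Defs
begin

text \<open>
  Identify \<open>\<rat>\<^sup>n\<close> with the field \<open>\<rat>[x] / (x\<^sup>n - 2)\<close>, and let \<open>T A\<close> be the matrix of multiplication by the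
  element given by a fixed column of \<open>A\<close>. Every value of \<open>T\<close> is then zero or invertible. Whether a
  given column of \<open>A\<close> vanishes depends only on the \<open>\<L>\<close>-class of \<open>A\<close>, and all invertible matrices are
  \<open>\<H>\<close>-related, so \<open>T\<close> preserves \<open>\<L>\<close> and \<open>\<H>\<close>. It maps a matrix of rank one to an invertible one, which
  \<open>A \<mapsto> P A X\<close> cannot do when \<open>n \<ge> 2\<close>.
\<close>

text \<open>Coefficient of \<open>x^i\<close> in the product of the polynomials with coefficients
  \<open>p\<close> and \<open>q\<close> (indices below \<open>N\<close>), reduced by
  \<open>x^N = 2\<close>: terms that wrap around pick up the factor 2.\<close>

definition twisted_conv :: "nat \<Rightarrow> (nat \<Rightarrow> 'a::comm_ring_1) \<Rightarrow> (nat \<Rightarrow> 'a) \<Rightarrow> nat \<Rightarrow> 'a" where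
  "twisted_conv N p q i = (\<Sum>j<N. (if j \<le> i then p (i - j) else 2 * p (N + i - j)) * q j)"

text \<open>
  This is Eisenstein's argument in terms of valuations: \<open>x\<close> is a uniformizer above 2, and \<open>p\<close> and \<open>q\<close> have
  valuations \<open>a\<close> and \<open>b\<close>, so their product has valuation \<open>a + b\<close>.
\<close>
lemma twisted_conv_int_nonzero:
  fixes p q :: "nat \<Rightarrow> int"
  assumes a: "a < N" "odd (p a)" "\<And>i. i < a \<Longrightarrow> even (p i)"
    and b: "b < N" "odd (q b)" "\<And>i. i < b \<Longrightarrow> even (q i)"
  shows "\<exists>i<N. twisted_conv N p q i \<noteq> 0"
proof (cases "a + b < N")
  case True
  \<comment> \<open>Coefficient \<open>a + b\<close> is odd: its term at \<open>j = b\<close> is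
    \<open>p a * q b\<close>, and every other term has an even entry of \<open>p\<close> or
    \<open>q\<close> or the wrap-around factor 2.\<close>
  let ?f = "\<lambda>j. (if j \<le> a + b then p (a + b - j) else 2 * p (N + (a + b) - j)) * q j"
  have "even (?f j)" if "j \<in> {..<N} - {b}" for j
  proof (cases "j < b")
    case False
    with that have "a + b - j < a \<or> \<not> j \<le> a + b" by auto
    then show ?thesis using a(3) by auto
  qed (use b(3) in auto)
  then have "even (sum ?f ({..<N} - {b}))" by (rule dvd_sum)
  moreover have "sum ?f {..<N} = ?f b + sum ?f ({..<N} - {b})"
    using b(1) by (intro sum.remove) auto
  moreover have "odd (?f b)" using a b by simp
  ultimately have "odd (twisted_conv N p q (a + b))"
    by (simp add: twisted_conv_def)
  then show ?thesis using True by (metis even_zero)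
next
  case False
  \<comment> \<open>As \<open>x^(a + b) = 2 * x^c\<close>, consider coefficient \<open>c\<close>
    modulo 4: the term at \<open>j = b\<close> is twice an odd number, and every other term contains
    two even factors.\<close>
  define c where "c = a + b - N"
  have c: "c < a" "c < b" "c < N" "N + c = a + b" using False a(1) b(1) by (auto simp: c_def)
  let ?f = "\<lambda>j. (if j \<le> c then p (c - j) else 2 * p (N + c - j)) * q j"
  have "2 * 2 dvd ?f j" if j: "j \<in> {..<N} - {b}" for j
  proof -
    consider "j \<le> c" | "c < j" "j < b" | "b < j" "c < j" using j c by force
    then show ?thesis
    proof cases
      case 1
      then have "2 * 2 dvd p (c - j) * q j"
        using c a(3)[of "c - j"] b(3)[of j] by (intro mult_dvd_mono) auto
      then show ?thesis using 1 by simp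
    next
      case 2
      then have "2 * 2 dvd (2 * p (N + c - j)) * q j" using b(3)[of j] by (intro mult_dvd_mono) auto
      then show ?thesis using 2 by simp
    next
      case 3
      then have "N + c - j < a" using c j a(1) by auto
      then have "2 * 2 dvd 2 * p (N + c - j)" using a(3) by (intro mult_dvd_mono) auto
      then show ?thesis using 3 by simp
    qed
  qed
  then have "4 dvd sum ?f ({..<N} - {b})" by (intro dvd_sum) force
  moreover have "sum ?f {..<N} = ?f b + sum ?f ({..<N} - {b})"
    using b(1) by (intro sum.remove) auto
  moreover have "?f b = 2 * (p a * q b)" using c by simp
  moreover have "odd (p a * q b)" using a b by simp
  moreover have "2 * x + y \<noteq> 0" if "4 dvd y" "odd x" for x y :: int using that by presburger
  ultimately have "twisted_conv N p q c \<noteq> 0"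
    unfolding twisted_conv_def by metis
  then show ?thesis using c by blast
qed

lemma common_denominator:
  fixes v :: "'a \<Rightarrow> rat"
  assumes "finite I"
  shows "\<exists>d::int. d \<noteq> 0 \<and> (\<forall>i\<in>I. of_int d * v i \<in> \<int>)"
  using assms
proof (induction I rule: finite_induct)
  case empty
  show ?case by (intro exI[of _ 1]) simp
next
  case (insert x I)
  then obtain d :: int where d: "d \<noteq> 0" "\<And>i. i \<in> I \<Longrightarrow> of_int d * v i \<in> \<int>" by blast
  obtain m n :: int where mn: "v x = of_int m / of_int n" "n \<noteq> 0"
    by (metis Fract_of_int_quotient Rat_cases less_irrefl)
  have "of_int (n * d) * v x = of_int (d * m)" using mn by simp
  moreover have "of_int (n * d) * v i = of_int n * (of_int d * v i)" for i by simp
  ultimately have "\<forall>i\<in>insert x I. of_int (n * d) * v i \<in> \<int>"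
    by (metis Ints_mult Ints_of_int d(2) insertE)
  then show ?case using d(1) mn(2) by (intro exI[of _ "n * d"]) simp
qed

text \<open>Clear denominators and divide by the gcd: the quotients cannot all be even, and
  \<open>a\<close> is the first index of an odd one. This prepares a rational vector for
  \<open>twisted_conv_int_nonzero\<close>.\<close>

lemma primitive_multiple:
  fixes v :: "nat \<Rightarrow> rat"
  assumes "\<exists>i<N. v i \<noteq> 0"
  shows "\<exists>c z a. c \<noteq> 0 \<and> (\<forall>i<N. v i = c * of_int (z i)) \<and>
           a < N \<and> odd (z a) \<and> (\<forall>i<a. even (z i :: int))"
proof -
  obtain d :: int where d: "d \<noteq> 0" "\<And>i. i < N \<Longrightarrow> of_int d * v i \<in> \<int>"
    using common_denominator[of "{..<N}" v] by auto
  define y where "y i = \<lfloor>of_int d * v i\<rfloor>" for i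
  have y: "of_int (y i) = of_int d * v i" if "i < N" for i
    using d(2)[OF that] by (simp add: y_def of_int_floor)
  define g where "g = Gcd (y ` {..<N})"
  have g0: "g \<noteq> 0"
  proof
    assume "g = 0"
    then have "\<forall>i<N. y i = 0" by (auto simp: g_def)
    then show False using assms y d(1) by (metis mult_eq_0_iff of_int_0 of_int_eq_0_iff)
  qed
  define z where "z i = y i div g" for i
  have z: "y i = g * z i" if "i < N" for i
    using that by (simp add: z_def g_def)
  have ex: "\<exists>a. a < N \<and> odd (z a)"
  proof (rule ccontr)
    assume "\<not> ?thesis"
    \<comment> \<open>Otherwise twice the gcd would divide every \<open>y i\<close>, hence the gcd
      itself.\<close>
    then have "g * 2 dvd y i" if "i < N" for i using that z by (metis dvd_triv_left mult_dvd_mono dvd_refl)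
    then have "g * 2 dvd g" unfolding g_def by (intro Gcd_greatest) (auto simp: g_def)
    then show False using g0 by (simp add: zdvd_not_zless)
  qed
  define a where "a = (LEAST a. a < N \<and> odd (z a))"
  have a: "a < N" "odd (z a)" using LeastI_ex[OF ex] by (auto simp: a_def)
  have "even (z i)" if "i < a" for i
    using not_less_Least[of i "\<lambda>a. a < N \<and> odd (z a)"] that a(1) by (auto simp: a_def)
  moreover have "v i = (of_int g / of_int d) * of_int (z i)" if "i < N" for i
    using y[OF that] z[OF that] d(1) by (simp add: field_simps)
  ultimately show ?thesis using a g0 d(1)
    by (intro exI[of _ "of_int g / of_int d"] exI[of _ z] exI[of _ a]) auto
qed

text \<open>By bilinearity the scalars factor out, leaving the integer case. Thus Q[x]/(x^N - 2) has
  no zero divisors.\<close>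

lemma twisted_conv_rat_nonzero:
  fixes p q :: "nat \<Rightarrow> rat"
  assumes "\<exists>i<N. p i \<noteq> 0" "\<exists>i<N. q i \<noteq> 0"
  shows "\<exists>i<N. twisted_conv N p q i \<noteq> 0"
proof -
  obtain c z a where p: "c \<noteq> 0" "\<And>i. i < N \<Longrightarrow> p i = c * of_int (z i)"
    "a < N" "odd (z a)" "\<And>i. i < a \<Longrightarrow> even (z i)"
    using primitive_multiple[OF assms(1)] by blast
  obtain d y b where q: "d \<noteq> 0" "\<And>i. i < N \<Longrightarrow> q i = d * of_int (y i)"
    "b < N" "odd (y b)" "\<And>i. i < b \<Longrightarrow> even (y i)"
    using primitive_multiple[OF assms(2)] by blast
  obtain i where i: "i < N" "twisted_conv N z y i \<noteq> 0"
    using twisted_conv_int_nonzero[of a N z b y] p(3-5) q(3-5) by blast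
  have "twisted_conv N p q i = c * d * of_int (twisted_conv N z y i)"
    unfolding twisted_conv_def of_int_sum sum_distrib_left
    using i(1) by (intro sum.cong) (auto simp: p(2) q(2))
  then show ?thesis using i p(1) q(1) by (intro exI[of _ i]) auto
qed

text \<open>The enumeration \<open>f\<close> makes coordinate \<open>i\<close> the coefficient of \<open>x\<close> to the power \<open>f i\<close>.\<close>
definition mult_matrix :: "('n::finite \<Rightarrow> nat) \<Rightarrow> 'a::comm_ring_1 ^ 'n \<Rightarrow> 'a ^ 'n ^ 'n" where
  "mult_matrix f v = (\<chi> i j. if f j \<le> f i then v $ inv f (f i - f j)
                             else 2 * v $ inv f (CARD('n) + f i - f j))"

lemma mult_matrix_mult_vec:
  fixes f :: "'n::finite \<Rightarrow> nat"
  assumes "bij_betw f UNIV {..<CARD('n)}"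
  shows "(mult_matrix f v *v u) $ i = twisted_conv CARD('n) (\<lambda>k. v $ inv f k) (\<lambda>k. u $ inv f k) (f i)"
proof -
  have "inv f (f j) = j" for j using assms by (simp add: bij_betw_def)
  then show ?thesis
    unfolding matrix_vector_mult_def mult_matrix_def twisted_conv_def
    by (simp add: sum.reindex_bij_betw[OF assms, symmetric])
qed

text \<open>Without zero divisors, multiplication by \<open>v\<close> has trivial kernel, which
  suffices for a square matrix.\<close>

lemma invertible_mult_matrix:
  fixes f :: "'n::finite \<Rightarrow> nat" and v :: "rat ^ 'n"
  assumes f: "bij_betw f UNIV {..<CARD('n)}" and "v \<noteq> 0"
  shows "invertible (mult_matrix f v)"
proof -
  have nz: "\<exists>k<CARD('n). w $ inv f k \<noteq> 0" if "w \<noteq> 0" for w :: "rat ^ 'n"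
  proof -
    obtain i where "w $ i \<noteq> 0" using \<open>w \<noteq> 0\<close> by (auto simp: vec_eq_iff)
    moreover have "inv f (f i) = i" "f i < CARD('n)" using f by (auto simp: bij_betw_def)
    ultimately show ?thesis by metis
  qed
  have "u = 0" if u: "mult_matrix f v *v u = 0" for u
  proof (rule ccontr)
    assume "u \<noteq> 0"
    then obtain k where k: "k < CARD('n)"
      "twisted_conv CARD('n) (\<lambda>k. v $ inv f k) (\<lambda>k. u $ inv f k) k \<noteq> 0"
      using twisted_conv_rat_nonzero[OF nz[OF \<open>v \<noteq> 0\<close>] nz] by blast
    obtain i where "k = f i" using f k(1) by (auto simp: bij_betw_def)
    with k(2) show False using u mult_matrix_mult_vec[OF f, of v u i] by simp
  qed
  then show ?thesis using matrix_left_invertible_ker invertible_left_inverse by blast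
qed

lemma green_H_refl: "green_H A A"
  unfolding green_H_def green_L_def green_R_def by (metis matrix_mul_lid matrix_mul_rid)

lemma green_H_invertible:
  assumes "invertible A" "invertible B"
  shows "green_H A B"
proof -
  obtain A' where A': "A ** A' = mat 1" "A' ** A = mat 1" using assms(1) invertible_def by blast
  obtain B' where B': "B ** B' = mat 1" "B' ** B = mat 1" using assms(2) invertible_def by blast
  have "A = (A ** B') ** B" "B = (B ** A') ** A"
    using A' B' by (simp_all add: matrix_mul_assoc[symmetric])
  moreover have "A = B ** (B' ** A)" "B = A ** (A' ** B)"
    using A' B' by (simp_all add: matrix_mul_assoc)
  ultimately show ?thesis unfolding green_H_def green_L_def green_R_def by blast
qed

lemma column_mult: "column j (X ** B) = X *v column j B"
  by (simp add: column_def vec_eq_iff matrix_matrix_mult_def matrix_vector_mult_def)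

text \<open>Left multiplication acts on each column separately, so it keeps zero columns
  zero.\<close>

lemma green_L_column_eq_0:
  assumes "green_L A B"
  shows "column j A = 0 \<longleftrightarrow> column j B = 0"
  using assms unfolding green_L_def by (metis column_mult matrix_vector_mult_0_right)

theorem corollary3p23:
  assumes "CARD('n::finite) \<ge> 2"
  shows "\<exists>T :: rat ^ 'n ^ 'n \<Rightarrow> rat ^ 'n ^ 'n.
           Vector_Spaces.linear mat_scale mat_scale T \<and>
           \<not> bij T \<and>
           preserves_rel T green_L \<and>
           preserves_rel T green_H \<and>
           \<not> (\<exists>P X. invertible P \<and> (\<forall>A. T A = P ** A ** X))"
proof -
  obtain f :: "'n \<Rightarrow> nat" where f: "bij_betw f UNIV {..<CARD('n)}"
    using ex_bij_betw_finite_nat[of "UNIV :: 'n set"] by (auto simp: atLeast0LessThan)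
  obtain r s :: 'n where rs: "r \<noteq> s"
    using assms by (metis card_2_iff' ex_card UNIV_I)
  define T :: "rat ^ 'n ^ 'n \<Rightarrow> rat ^ 'n ^ 'n" where "T A = mult_matrix f (column r A)" for A
  \<comment> \<open>\<open>E s\<close> has zero column \<open>r\<close> and refutes injectivity;
    \<open>E r\<close> is singular with nonzero column \<open>r\<close>.\<close>
  define E :: "'n \<Rightarrow> rat ^ 'n ^ 'n" where "E k = (\<chi> i j. if i = r \<and> j = k then 1 else 0)" for k
  have T0: "T A = 0" if "column r A = 0" for A
    using that by (simp add: T_def mult_matrix_def vec_eq_iff)
  have T1: "invertible (T A)" if "column r A \<noteq> 0" for A
    using invertible_mult_matrix[OF f that] by (simp add: T_def)
  have linear: "Vector_Spaces.linear mat_scale mat_scale T"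
    unfolding Vector_Spaces.linear_def module_hom_def module_hom_axioms_def
    using vector_space_mat_scale
    by (auto simp: vector_space_def module_def T_def mult_matrix_def mat_scale_def column_def
        vec_eq_iff algebra_simps)
  have "column r (E s) = 0" using rs by (auto simp: E_def column_def vec_eq_iff)
  moreover have "column r (0 :: rat ^ 'n ^ 'n) = 0" by (simp add: column_def vec_eq_iff)
  ultimately have "T (E s) = T 0" using T0 by simp
  moreover have "E s \<noteq> 0" by (auto simp: E_def vec_eq_iff)
  ultimately have nbij: "\<not> bij T" by (metis bij_def injD)
  \<comment> \<open>The images are both zero or both invertible, so \<L>-related arguments already
    have \<H>-related images; this yields both preservation claims.\<close>
  have L_H: "green_H (T A) (T B)" if "green_L A B" for A B
    using green_L_column_eq_0[OF that, of r] T0 T1 green_H_refl green_H_invertible by metis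
  have "preserves_rel T green_L" "preserves_rel T green_H"
    using L_H by (auto simp: preserves_rel_def green_H_def)
  moreover have "\<not> (\<exists>P X. invertible P \<and> (\<forall>A. T A = P ** A ** X))"
  proof
    assume "\<exists>P X. invertible P \<and> (\<forall>A. T A = P ** A ** X)"
    then obtain P X where PX: "T (E r) = P ** E r ** X" by blast
    have "column r (E r) \<noteq> 0" by (auto simp: E_def column_def vec_eq_iff)
    then have "det (T (E r)) \<noteq> 0" using T1 invertible_det_nz by blast
    moreover have "row s (E r) = 0" using rs by (auto simp: E_def row_def vec_eq_iff)
    then have "det (E r) = 0" by (rule det_zero_row)
    ultimately show False using PX by (simp add: det_mul)
  qed
  ultimately show ?thesis using linear nbij by blast
qed

end
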